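(* Let $k\in\mathbb{N}$, $R>0$, let $\phi$ satisfy Assumption B of the context, and let $\varepsilon_1,\dots,\varepsilon_n$ be independent identically distributed normal random variables with zero mean and positive variance. Set $$\Theta=\Big\{\theta=(b_1,\tau_1,b_2,\tau_2,\dots,b_k,\tau_k,b_{k+1}):\ f_\theta:=\sum_{i=1}^{k+1}b_i1_{[\tau_{i-1},\tau_i)}\in T_{k,R}\Big\}$$ (with $\tau_0=-\infty$, $\tau_{k+1}=\infty$). For arbitrary fixed design points $x_1,\dots,x_n\in[0,1]$ denote by $P^n_\theta$ the probability measure associated with the observations $Y_i=(\Phi f_\theta)(x_i)+\varepsilon_i$, $i=1,\dots,n$, where $\Phi g=\phi*g$. Then there exists $c_0>0$, independent of $n$ and of $x_1,\dots,x_n$, such that $$\inf_{\hat\theta}\sup_{\theta\in\Theta}P^n_\theta\big(\|\hat\theta-\theta\|_2\ge c_0n^{-1/2}\big)>0,$$ where the infimum is over all estimators $\hat\theta$ (measurable functions of $Y_1,\dots,Y_n$ with values in $\mathbb{R}^{2k+1}$) and $\|\cdot\|_2$ is the Euclidean norm.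
   Context: $\Gamma_k=\{(\gamma_0,\dots,\gamma_{k+1}):-\infty=\gamma_0<0<\gamma_1<\dots<\gamma_k<1<\gamma_{k+1}=\infty\}$; $T_k=\{\sum_{i=1}^{k+1}b_i1_{[\tau_{i-1},\tau_i)}:\tau\in\Gamma_k,\ b_i\in\mathbb{R}\}$; $T_{k,R}=\{g\in T_k:\|g\|_\infty<R\}$. In the definition of $\Theta$, $(\tau_0,\dots,\tau_{k+1})\in\Gamma_k$. $(\Phi g)(x)=\int_{\mathbb{R}}\phi(x-y)g(y)\,dy$. Put $\Delta_\phi(x,a,b)=\int_a^b\phi(x-y)\,dy$ if $a\neq b$ and $\Delta_\phi(x,a,a)=\phi(x-a)$. Assumption B: $\phi\in L_1(\mathbb{R})\cap L_2(\mathbb{R})\cap L_\infty(\mathbb{R})$ is real valued, piecewise continuous with finitely many jumps, and for every $m\in\mathbb{N}$ and every $-\infty=t_0\le 0<t_1\le\dots\le t_m<1\le t_{m+1}=\infty$ in which at most two subsequent $t_i$ are equal (no three coincide), the functions $\Delta_\phi(\cdot,t_0,t_1),\dots,\Delta_\phi(\cdot,t_m,t_{m+1})$ are linearly independent in $L_2([0,1])$. *)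

theory Defs
  imports "HOL-Probability.Probability" "HOL-Probability.Essential_Supremum"
begin

definition Linf_norm :: "(real \<Rightarrow> real) \<Rightarrow> ereal" where
  "Linf_norm g = esssup lborel (\<lambda>x. ereal \<bar>g x\<bar>)"

text \<open>A knot vector \<open>(\<gamma>\<^sub>0, \<dots>, \<gamma>\<^sub>k\<^sub>+\<^sub>1)\<close> is a function on the naturals of which only the
  values at \<open>0, \<dots>, k + 1\<close> matter.\<close>

definition Gamma :: "nat \<Rightarrow> (nat \<Rightarrow> ereal) set" where
  "Gamma k = {\<gamma>. \<gamma> 0 = -\<infinity> \<and> \<gamma> (k + 1) = \<infinity> \<and>
     (\<forall>i\<in>{1..k}. 0 < \<gamma> i \<and> \<gamma> i < 1) \<and> (\<forall>i\<le>k. \<gamma> i < \<gamma> (i + 1))}"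

definition step_fun :: "nat \<Rightarrow> (nat \<Rightarrow> real) \<Rightarrow> (nat \<Rightarrow> ereal) \<Rightarrow> real \<Rightarrow> real" where
  "step_fun k b \<tau> y =
     (\<Sum>i=1..k+1. b i * indicator {z. \<tau> (i - 1) \<le> ereal z \<and> ereal z < \<tau> i} y)"

definition T :: "nat \<Rightarrow> (real \<Rightarrow> real) set" where
  "T k = {step_fun k b \<tau> | b \<tau>. \<tau> \<in> Gamma k}"

definition T_bdd :: "nat \<Rightarrow> real \<Rightarrow> (real \<Rightarrow> real) set" where
  "T_bdd k R = {g \<in> T k. Linf_norm g < ereal R}"

definition Delta :: "(real \<Rightarrow> real) \<Rightarrow> real \<Rightarrow> ereal \<Rightarrow> ereal \<Rightarrow> real" where
  "Delta \<phi> x a b =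
     (if a \<noteq> b then (LBINT y=a..b. \<phi> (x - y)) else \<phi> (x - real_of_ereal a))"

text \<open>Continuous except at finitely many points, at each of which both one-sided limits exist in
  the reals; the value at an exceptional point is arbitrary.\<close>

definition piecewise_continuous :: "(real \<Rightarrow> real) \<Rightarrow> bool" where
  "piecewise_continuous \<phi> \<longleftrightarrow> (\<exists>S. finite S \<and> (\<forall>x. x \<notin> S \<longrightarrow> isCont \<phi> x) \<and>
     (\<forall>s\<in>S. (\<exists>l. (\<phi> \<longlongrightarrow> l) (at_left s)) \<and> (\<exists>l. (\<phi> \<longlongrightarrow> l) (at_right s))))"

text \<open>Linear independence of the classes of \<open>f\<^sub>0, \<dots>, f\<^sub>m\<close> in \<open>L\<^sub>2([0,1])\<close>, as a family: the zero
  vector of that space is the class of functions vanishing almost everywhere on \<open>[0,1]\<close>.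
  Membership of the \<open>f\<^sub>j\<close> in \<open>L\<^sub>2([0,1])\<close> is not part of the definition; it holds automatically
  where the definition is used below.\<close>

definition lin_indep_L2_unit :: "nat \<Rightarrow> (nat \<Rightarrow> real \<Rightarrow> real) \<Rightarrow> bool" where
  "lin_indep_L2_unit m f \<longleftrightarrow>
     (\<forall>c :: nat \<Rightarrow> real. (AE x in lborel. x \<in> {0..1} \<longrightarrow> (\<Sum>j\<le>m. c j * f j x) = 0) \<longrightarrow>
        (\<forall>j\<le>m. c j = 0))"

text \<open>Knots with multiplicity at most two; since they are sorted, it suffices to exclude three
  consecutive equal ones.\<close>

definition multi_knots :: "nat \<Rightarrow> (nat \<Rightarrow> ereal) set" where
  "multi_knots m = {t. t 0 = -\<infinity> \<and> t (m + 1) = \<infinity> \<and>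
     (\<forall>i\<in>{1..m}. 0 < t i \<and> t i < 1) \<and> (\<forall>i\<le>m. t i \<le> t (i + 1)) \<and>
     (\<forall>i<m. \<not> (t i = t (i + 1) \<and> t (i + 1) = t (i + 2)))}"

definition assumption_B :: "(real \<Rightarrow> real) \<Rightarrow> bool" where
  "assumption_B \<phi> \<longleftrightarrow>
     integrable lborel \<phi> \<and> integrable lborel (\<lambda>x. (\<phi> x)\<^sup>2) \<and> Linf_norm \<phi> < \<infinity> \<and>
     piecewise_continuous \<phi> \<and>
     (\<forall>m\<ge>1. \<forall>t\<in>multi_knots m. lin_indep_L2_unit m (\<lambda>j x. Delta \<phi> x (t j) (t (j + 1))))"

definition conv_op :: "(real \<Rightarrow> real) \<Rightarrow> (real \<Rightarrow> real) \<Rightarrow> real \<Rightarrow> real" where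
  "conv_op \<phi> g x = (LBINT y. \<phi> (x - y) * g y)"

text \<open>A parameter \<open>(b\<^sub>1, \<tau>\<^sub>1, \<dots>, b\<^sub>k, \<tau>\<^sub>k, b\<^sub>k\<^sub>+\<^sub>1)\<close> in \<open>\<real>\<^sup>2\<^sup>k\<^sup>+\<^sup>1\<close> is an (extensional) function
  on \<open>{1..2k+1}\<close>: \<open>b\<^sub>i\<close> is entry \<open>2i - 1\<close> and \<open>\<tau>\<^sub>i\<close> is entry \<open>2i\<close>.\<close>

definition heights :: "(nat \<Rightarrow> real) \<Rightarrow> nat \<Rightarrow> real" where
  "heights \<theta> i = \<theta> (2 * i - 1)"

definition knots :: "nat \<Rightarrow> (nat \<Rightarrow> real) \<Rightarrow> nat \<Rightarrow> ereal" where
  "knots k \<theta> i = (if i = 0 then -\<infinity> else if i \<le> k then ereal (\<theta> (2 * i)) else \<infinity>)"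

definition f_param :: "nat \<Rightarrow> (nat \<Rightarrow> real) \<Rightarrow> real \<Rightarrow> real" where
  "f_param k \<theta> = step_fun k (heights \<theta>) (knots k \<theta>)"

definition Theta :: "nat \<Rightarrow> real \<Rightarrow> (nat \<Rightarrow> real) set" where
  "Theta k R = {\<theta> \<in> {1..2*k+1} \<rightarrow>\<^sub>E UNIV. knots k \<theta> \<in> Gamma k \<and> f_param k \<theta> \<in> T_bdd k R}"

text \<open>The law on \<open>\<real>\<^sup>n\<close> of \<open>(Y\<^sub>1, \<dots>, Y\<^sub>n)\<close>, for noise variables \<open>\<epsilon>\<^sub>i\<close> on \<open>M\<close>.\<close>

definition obs_law :: "'a measure \<Rightarrow> (nat \<Rightarrow> 'a \<Rightarrow> real) \<Rightarrow> (real \<Rightarrow> real) \<Rightarrow> nat \<Rightarrow>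
    nat \<Rightarrow> (nat \<Rightarrow> real) \<Rightarrow> (nat \<Rightarrow> real) \<Rightarrow> (nat \<Rightarrow> real) measure" where
  "obs_law M \<epsilon> \<phi> k n x \<theta> =
     distr M (Pi\<^sub>M {1..n} (\<lambda>_. borel))
       (\<lambda>\<omega>. \<lambda>i\<in>{1..n}. conv_op \<phi> (f_param k \<theta>) (x i) + \<epsilon> i \<omega>)"

definition estimators :: "nat \<Rightarrow> nat \<Rightarrow> ((nat \<Rightarrow> real) \<Rightarrow> (nat \<Rightarrow> real)) set" where
  "estimators n k = measurable (Pi\<^sub>M {1..n} (\<lambda>_. borel)) (Pi\<^sub>M {1..2*k+1} (\<lambda>_. borel))"

definition euclid_dist :: "nat \<Rightarrow> (nat \<Rightarrow> real) \<Rightarrow> (nat \<Rightarrow> real) \<Rightarrow> real" where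
  "euclid_dist d u v = L2_set (\<lambda>j. u j - v j) {1..d}"

end

theory Submission
  imports Defs
begin

text \<open>
  The bound is Le Cam's two-point method, applied along the direction of the first height. Fix
  equispaced knots and compare the parameter with all heights zero to the one whose first height
  is \<open>R / (2 * sqrt n)\<close>. They lie at Euclidean distance \<open>R / (2 * sqrt n)\<close>, so with
  \<open>c\<^sub>0 = R / 4\<close> no estimate can be within \<open>c\<^sub>0 / sqrt n\<close> of both. On the other hand
  \<open>\<phi>\<close> is integrable, so by \<open>\<parallel>\<phi> * g\<parallel>\<^sub>\<infinity> \<le> \<parallel>\<phi>\<parallel>\<^sub>1 \<parallel>g\<parallel>\<^sub>\<infinity>\<close> each of the \<open>n\<close> regression values
  moves by at most \<open>R * \<parallel>\<phi>\<parallel>\<^sub>1 / (2 * sqrt n)\<close>, wherever the design points are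
  (\<open>conv_one_step_bound\<close>). The two mean vectors are therefore at squared Euclidean distance at most
  \<open>(R * \<parallel>\<phi>\<parallel>\<^sub>1 / 2)\<^sup>2\<close>, uniformly in \<open>n\<close> and in the design, and two Gaussian laws whose means are
  that close cannot be separated by any test (\<open>gaussian_testing_bound\<close>).

  For the testing bound, let \<open>q\<close> be the Gaussian density centred at the midpoint of the two means.
  By the parallelogram identity, \<open>q\<^sup>2\<close> is \<open>exp (S / (4 * \<sigma>\<^sup>2))\<close> times the product of the two
  densities, where \<open>S\<close> is the squared distance of the means. The inequality of arithmetic and
  geometric means then bounds \<open>q\<close> by either density, up to a constant, plus a quarter of the
  other one; integrating the first bound over an event and the second over its complement gives
  a lower bound on the sum of the two errors.
\<close>

section \<open>Testing between two Gaussian laws\<close>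

text \<open>Both measures give a box the product of the one-dimensional masses.\<close>
lemma (in product_sigma_finite) density_PiM_prod:
  fixes f :: "'i \<Rightarrow> 'a \<Rightarrow> ennreal"
  assumes I: "finite I"
    and f [measurable]: "\<And>i. f i \<in> borel_measurable (M i)"
    and sf: "\<And>i. sigma_finite_measure (density (M i) (f i))"
  shows "density (Pi\<^sub>M I M) (\<lambda>y. \<Prod>i\<in>I. f i (y i)) = (\<Pi>\<^sub>M i\<in>I. density (M i) (f i))"
proof -
  interpret D: product_sigma_finite "\<lambda>i. density (M i) (f i)"
    using sf by (simp add: product_sigma_finite_def)
  show ?thesis
  proof (rule D.PiM_eqI[OF I])
    show "sets (density (Pi\<^sub>M I M) (\<lambda>y. \<Prod>i\<in>I. f i (y i))) = sets (\<Pi>\<^sub>M i\<in>I. density (M i) (f i))"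
      by (simp cong: sets_PiM_cong)
  next
    fix A :: "'i \<Rightarrow> 'a set"
    assume "\<And>i. i \<in> I \<Longrightarrow> A i \<in> sets (density (M i) (f i))"
    then have A [measurable]: "A i \<in> sets (M i)" if "i \<in> I" for i
      using that by simp
    have ind: "indicator (Pi\<^sub>E I A) y = (\<Prod>i\<in>I. indicator (A i) (y i) :: ennreal)"
      if y: "y \<in> space (Pi\<^sub>M I M)" for y
    proof (cases "y \<in> Pi\<^sub>E I A")
      case True
      then have "(\<Prod>i\<in>I. indicator (A i) (y i) :: ennreal) = 1"
        by (intro prod.neutral) (auto simp: PiE_iff)
      then show ?thesis using True by simp
    next
      case False
      then obtain i where "i \<in> I" "y i \<notin> A i"
        using y by (auto simp: space_PiM PiE_def)
      then have "(\<Prod>i\<in>I. indicator (A i) (y i) :: ennreal) = 0"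
        using I by (intro prod_zero bexI[of _ i]) auto
      then show ?thesis using False by simp
    qed
    have "emeasure (density (Pi\<^sub>M I M) (\<lambda>y. \<Prod>i\<in>I. f i (y i))) (Pi\<^sub>E I A)
        = (\<integral>\<^sup>+y. (\<Prod>i\<in>I. f i (y i)) * indicator (Pi\<^sub>E I A) y \<partial>Pi\<^sub>M I M)"
      using I A by (intro emeasure_density) (auto intro!: sets_PiM_I_finite)
    also have "\<dots> = (\<integral>\<^sup>+y. (\<Prod>i\<in>I. f i (y i) * indicator (A i) (y i)) \<partial>Pi\<^sub>M I M)"
      by (intro nn_integral_cong) (simp add: ind prod.distrib)
    also have "\<dots> = (\<Prod>i\<in>I. \<integral>\<^sup>+x. f i x * indicator (A i) x \<partial>M i)"
      using I A by (intro product_nn_integral_prod) auto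
    also have "\<dots> = (\<Prod>i\<in>I. emeasure (density (M i) (f i)) (A i))"
      using A by (intro prod.cong refl) (simp add: emeasure_density)
    finally show "emeasure (density (Pi\<^sub>M I M) (\<lambda>y. \<Prod>i\<in>I. f i (y i))) (Pi\<^sub>E I A)
        = (\<Prod>i\<in>I. emeasure (density (M i) (f i)) (A i))" .
  qed
qed

definition gaussian_density :: "'i set \<Rightarrow> ('i \<Rightarrow> real) \<Rightarrow> real \<Rightarrow> ('i \<Rightarrow> real) \<Rightarrow> real" where
  "gaussian_density I a \<sigma> y = (\<Prod>i\<in>I. normal_density (a i) \<sigma> (y i))"

definition gaussian_law :: "'i set \<Rightarrow> ('i \<Rightarrow> real) \<Rightarrow> real \<Rightarrow> ('i \<Rightarrow> real) measure" where
  "gaussian_law I a \<sigma> = density (Pi\<^sub>M I (\<lambda>_. lborel)) (\<lambda>y. ennreal (gaussian_density I a \<sigma> y))"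

lemma gaussian_density_nonneg: "0 \<le> gaussian_density I a \<sigma> y"
  unfolding gaussian_density_def by (intro prod_nonneg) (simp add: normal_density_nonneg)

lemma measurable_gaussian_density [measurable]:
  "gaussian_density I a \<sigma> \<in> borel_measurable (Pi\<^sub>M I (\<lambda>_. lborel))"
  unfolding gaussian_density_def by measurable

lemma sets_gaussian_law: "sets (gaussian_law I a \<sigma>) = sets (Pi\<^sub>M I (\<lambda>_. borel))"
  unfolding gaussian_law_def by (simp cong: sets_PiM_cong)

lemma emeasure_gaussian_law:
  assumes "A \<in> sets (Pi\<^sub>M I (\<lambda>_. borel))"
  shows "emeasure (gaussian_law I a \<sigma>) A =
    (\<integral>\<^sup>+y. ennreal (gaussian_density I a \<sigma> y) * indicator A y \<partial>Pi\<^sub>M I (\<lambda>_. lborel))"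
  using assms unfolding gaussian_law_def
  by (subst emeasure_density) (auto cong: sets_PiM_cong)

lemma gaussian_law_eq_PiM:
  assumes "finite I" "\<sigma> > 0"
  shows "gaussian_law I a \<sigma> = (\<Pi>\<^sub>M i\<in>I. density lborel (normal_density (a i) \<sigma>))"
proof -
  interpret product_sigma_finite "\<lambda>_::'a. lborel :: real measure"
    by standard
  have "sigma_finite_measure (density lborel (normal_density (a i) \<sigma>))" for i
    using prob_space_normal_density[OF \<open>\<sigma> > 0\<close>]
    by (intro finite_measure.axioms(1) prob_space.axioms(1))
  then show ?thesis
    unfolding gaussian_law_def gaussian_density_def
    by (subst density_PiM_prod[OF \<open>finite I\<close>, symmetric])
       (auto simp: prod_ennreal normal_density_nonneg)
qed

lemma prob_space_gaussian_law:
  assumes "finite I" "\<sigma> > 0"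
  shows "prob_space (gaussian_law I a \<sigma>)"
  unfolding gaussian_law_eq_PiM[OF assms]
  by (intro prob_space_PiM prob_space_normal_density assms)

lemma (in prob_space) distr_shifted_normal:
  assumes indep: "indep_vars (\<lambda>_. borel) \<epsilon> I"
    and normal: "\<And>i. i \<in> I \<Longrightarrow> distributed M lborel (\<epsilon> i) (normal_density 0 \<sigma>)"
    and I: "finite I" "I \<noteq> {}" and \<sigma>: "\<sigma> > 0"
  shows "distr M (Pi\<^sub>M I (\<lambda>_. borel)) (\<lambda>\<omega>. \<lambda>i\<in>I. a i + \<epsilon> i \<omega>) = gaussian_law I a \<sigma>"
proof -
  have "indep_vars (\<lambda>_. borel) (\<lambda>i \<omega>. a i + \<epsilon> i \<omega>) I"
    by (rule indep_vars_compose2[OF indep]) simp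
  moreover have rv: "random_variable borel (\<lambda>\<omega>. a i + \<epsilon> i \<omega>)" if "i \<in> I" for i
    using normal[OF that] by (auto simp: distributed_def)
  ultimately have "distr M (Pi\<^sub>M I (\<lambda>_. borel)) (\<lambda>\<omega>. \<lambda>i\<in>I. a i + \<epsilon> i \<omega>)
      = (\<Pi>\<^sub>M i\<in>I. distr M borel (\<lambda>\<omega>. a i + \<epsilon> i \<omega>))"
    using indep_vars_iff_distr_eq_PiM'[OF I(2), where M' = "\<lambda>_. borel" and X = "\<lambda>i \<omega>. a i + \<epsilon> i \<omega>"]
    by simp
  also have "\<dots> = (\<Pi>\<^sub>M i\<in>I. density lborel (normal_density (a i) \<sigma>))"
  proof (rule PiM_cong[OF refl])
    fix i assume "i \<in> I"
    have "distributed M lborel (\<lambda>\<omega>. a i + \<epsilon> i \<omega>) (normal_density (a i) \<sigma>)"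
      using normal_density_affine[OF normal[OF \<open>i \<in> I\<close>] \<sigma>, of 1 "a i"] by simp
    then show "distr M borel (\<lambda>\<omega>. a i + \<epsilon> i \<omega>) = density lborel (normal_density (a i) \<sigma>)"
      by (simp add: distributed_def cong: distr_cong)
  qed
  finally show ?thesis
    by (simp add: gaussian_law_eq_PiM[OF I(1) \<sigma>])
qed

text \<open>By \<open>(y - a)\<^sup>2 + (y - b)\<^sup>2 = 2 * (y - (a + b) / 2)\<^sup>2 + (a - b)\<^sup>2 / 2\<close>.\<close>
lemma normal_density_midpoint:
  assumes "\<sigma> > 0"
  shows "(normal_density ((a + b) / 2) \<sigma> y)\<^sup>2
    = exp ((a - b)\<^sup>2 / (4 * \<sigma>\<^sup>2)) * (normal_density a \<sigma> y * normal_density b \<sigma> y)"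
proof -
  have exps: "2 * (- (y - (a + b) / 2)\<^sup>2 / (2 * \<sigma>\<^sup>2)) = (a - b)\<^sup>2 / (4 * \<sigma>\<^sup>2)
      + (- (y - a)\<^sup>2 / (2 * \<sigma>\<^sup>2) + - (y - b)\<^sup>2 / (2 * \<sigma>\<^sup>2))"
    using assms by (simp add: field_simps power2_eq_square)
  define K where "K = 1 / sqrt (2 * pi * \<sigma>\<^sup>2)"
  have nd: "normal_density m \<sigma> y = K * exp (- (y - m)\<^sup>2 / (2 * \<sigma>\<^sup>2))" for m
    by (simp add: normal_density_def K_def)
  have "(normal_density ((a + b) / 2) \<sigma> y)\<^sup>2
      = K\<^sup>2 * exp (2 * (- (y - (a + b) / 2)\<^sup>2 / (2 * \<sigma>\<^sup>2)))"
    unfolding nd by (simp add: power_mult_distrib flip: exp_double)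
  also have "\<dots> = exp ((a - b)\<^sup>2 / (4 * \<sigma>\<^sup>2)) * (normal_density a \<sigma> y * normal_density b \<sigma> y)"
    unfolding exps exp_add nd by (simp add: power2_eq_square)
  finally show ?thesis .
qed

text \<open>The density at the midpoint is the geometric mean of the two densities times the square
  root of \<open>D\<close>, so this is the inequality of arithmetic and geometric means, with weights chosen
  such that the second density gets the factor \<open>1 / 4\<close>.\<close>
lemma gaussian_density_midpoint_le:
  fixes a b :: "'i \<Rightarrow> real"
  assumes "finite I" "\<sigma> > 0"
  defines "D \<equiv> exp ((\<Sum>i\<in>I. (a i - b i)\<^sup>2) / (4 * \<sigma>\<^sup>2))"
  shows "gaussian_density I (\<lambda>i. (a i + b i) / 2) \<sigma> y
    \<le> D * gaussian_density I a \<sigma> y + gaussian_density I b \<sigma> y / 4"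
proof -
  define p q where "p = gaussian_density I a \<sigma> y" and "q = gaussian_density I b \<sigma> y"
  have [simp]: "p \<ge> 0" "q \<ge> 0" "D \<ge> 0"
    by (auto simp: p_def q_def D_def gaussian_density_nonneg)
  have "D = (\<Prod>i\<in>I. exp ((a i - b i)\<^sup>2 / (4 * \<sigma>\<^sup>2)))"
    using \<open>finite I\<close> by (simp add: D_def sum_divide_distrib exp_sum)
  then have "(gaussian_density I (\<lambda>i. (a i + b i) / 2) \<sigma> y)\<^sup>2 = D * (p * q)"
    by (simp add: gaussian_density_def p_def q_def normal_density_midpoint[OF \<open>\<sigma> > 0\<close>]
      prod.distrib prod_power_distrib)
  also have "\<dots> \<le> (D * p + q / 4)\<^sup>2"
    using zero_le_power2[of "D * p - q / 4"] by (simp add: power2_eq_square field_simps)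
  finally show ?thesis
    unfolding p_def[symmetric] q_def[symmetric] by (rule power2_le_imp_le) simp
qed

text \<open>Here \<open>A\<close> is the rejection region of a test of the mean \<open>a\<close> against the mean \<open>b\<close>.
  The midpoint law \<open>Q\<close> satisfies \<open>Q A \<le> D * P\<^sub>a A + 1 / 4\<close> and, with the two means exchanged,
  \<open>Q A\<^sup>c \<le> D * P\<^sub>b A\<^sup>c + 1 / 4\<close>; these add up to \<open>1\<close> on the left.\<close>
lemma gaussian_testing_bound:
  fixes a b :: "'i \<Rightarrow> real"
  assumes I: "finite I" and \<sigma>: "\<sigma> > 0"
    and A: "A \<in> sets (Pi\<^sub>M I (\<lambda>_. borel))"
    and s: "(\<Sum>i\<in>I. (a i - b i)\<^sup>2) \<le> S"
  shows "1 / (2 * exp (S / (4 * \<sigma>\<^sup>2)))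
    \<le> measure (gaussian_law I a \<sigma>) A + measure (gaussian_law I b \<sigma>) (space (Pi\<^sub>M I (\<lambda>_. borel)) - A)"
proof -
  define D where "D = exp (S / (4 * \<sigma>\<^sup>2))"
  define m where "m = (\<lambda>i. (a i + b i) / 2)"
  have half: "measure (gaussian_law I m \<sigma>) B \<le> D * measure (gaussian_law I u \<sigma>) B + 1 / 4"
    if B: "B \<in> sets (Pi\<^sub>M I (\<lambda>_. borel))"
      and le: "\<And>y. gaussian_density I m \<sigma> y \<le> D * gaussian_density I u \<sigma> y + gaussian_density I v \<sigma> y / 4"
    for u v B
  proof -
    interpret P: prob_space "gaussian_law I m \<sigma>"
      by (rule prob_space_gaussian_law[OF I \<sigma>])
    interpret U: prob_space "gaussian_law I u \<sigma>"
      by (rule prob_space_gaussian_law[OF I \<sigma>])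
    interpret V: prob_space "gaussian_law I v \<sigma>"
      by (rule prob_space_gaussian_law[OF I \<sigma>])
    have [measurable]: "B \<in> sets (Pi\<^sub>M I (\<lambda>_. lborel))"
      using B by (simp cong: sets_PiM_cong)
    have "ennreal (gaussian_density I m \<sigma> y) * indicator B y
        \<le> ennreal D * (ennreal (gaussian_density I u \<sigma> y) * indicator B y)
          + ennreal (1 / 4) * (ennreal (gaussian_density I v \<sigma> y) * indicator B y)" for y
      using ennreal_leI[OF le[of y]]
      by (auto simp: D_def gaussian_density_nonneg field_simps
            simp flip: ennreal_mult' ennreal_plus split: split_indicator)
    then have "emeasure (gaussian_law I m \<sigma>) B
        \<le> (\<integral>\<^sup>+y. ennreal D * (ennreal (gaussian_density I u \<sigma> y) * indicator B y)
          + ennreal (1 / 4) * (ennreal (gaussian_density I v \<sigma> y) * indicator B y) \<partial>Pi\<^sub>M I (\<lambda>_. lborel))"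
      unfolding emeasure_gaussian_law[OF B] by (rule nn_integral_mono)
    also have "\<dots> = ennreal D * emeasure (gaussian_law I u \<sigma>) B
        + ennreal (1 / 4) * emeasure (gaussian_law I v \<sigma>) B"
      unfolding emeasure_gaussian_law[OF B]
      by (simp add: nn_integral_add nn_integral_cmult)
    finally have "measure (gaussian_law I m \<sigma>) B
        \<le> D * measure (gaussian_law I u \<sigma>) B + 1 / 4 * measure (gaussian_law I v \<sigma>) B"
      by (simp add: P.emeasure_eq_measure U.emeasure_eq_measure V.emeasure_eq_measure D_def
           flip: ennreal_mult' ennreal_plus)
    also have "\<dots> \<le> D * measure (gaussian_law I u \<sigma>) B + 1 / 4"
      by simp
    finally show ?thesis .
  qed
  have DD: "exp ((\<Sum>i\<in>I. (a i - b i)\<^sup>2) / (4 * \<sigma>\<^sup>2)) \<le> D"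
    using s by (simp add: D_def divide_right_mono)
  have le_a: "gaussian_density I m \<sigma> y \<le> D * gaussian_density I a \<sigma> y + gaussian_density I b \<sigma> y / 4" for y
    using gaussian_density_midpoint_le[OF I \<sigma>, of a b y]
      mult_right_mono[OF DD gaussian_density_nonneg[of I a \<sigma> y]]
    by (simp add: m_def)
  have le_b: "gaussian_density I m \<sigma> y \<le> D * gaussian_density I b \<sigma> y + gaussian_density I a \<sigma> y / 4" for y
    using gaussian_density_midpoint_le[OF I \<sigma>, of b a y]
      mult_right_mono[OF DD gaussian_density_nonneg[of I b \<sigma> y]]
    by (simp add: m_def add.commute power2_commute)
  interpret P: prob_space "gaussian_law I m \<sigma>"
    by (rule prob_space_gaussian_law[OF I \<sigma>])
  have sp: "space (gaussian_law I m \<sigma>) = space (Pi\<^sub>M I (\<lambda>_. borel))"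
    by (rule sets_eq_imp_space_eq[OF sets_gaussian_law])
  have "1 = measure (gaussian_law I m \<sigma>) A
      + measure (gaussian_law I m \<sigma>) (space (Pi\<^sub>M I (\<lambda>_. borel)) - A)"
    using P.prob_compl[of A] A by (simp add: sets_gaussian_law sp)
  also have "\<dots> \<le> (D * measure (gaussian_law I a \<sigma>) A + 1 / 4)
      + (D * measure (gaussian_law I b \<sigma>) (space (Pi\<^sub>M I (\<lambda>_. borel)) - A) + 1 / 4)"
    using A by (intro add_mono half[of _ a b] half[of _ b a] le_a le_b) auto
  finally have "1 / 2 \<le> D * (measure (gaussian_law I a \<sigma>) A
      + measure (gaussian_law I b \<sigma>) (space (Pi\<^sub>M I (\<lambda>_. borel)) - A))"
    by (simp add: algebra_simps)
  then show ?thesis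
    unfolding D_def[symmetric] by (simp add: D_def field_simps)
qed

section \<open>A pair of nearby step functions\<close>

text \<open>The parameters to be compared share their knots and differ in the first height only: with the
  knots fixed, the step function and its image under convolution are linear in that height.\<close>
definition one_step_param :: "nat \<Rightarrow> real \<Rightarrow> nat \<Rightarrow> real" where
  "one_step_param k h = (\<lambda>j\<in>{1..2*k+1}.
     if j = 1 then h else if even j then real (j div 2) / real (k + 1) else 0)"

lemma knots_one_step_param_Gamma: "knots k (one_step_param k h) \<in> Gamma k"
  by (auto simp: Gamma_def knots_def one_step_param_def divide_strict_right_mono field_simps)

lemma f_param_one_step:
  "f_param k (one_step_param k h) y = h * indicator {z. ereal z < knots k (one_step_param k h) 1} y"
proof -
  have "f_param k (one_step_param k h) y = (\<Sum>i=1..k+1. if i = 1 then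
      h * indicator {z. ereal z < knots k (one_step_param k h) 1} y else 0)"
    unfolding f_param_def step_fun_def
    by (intro sum.cong refl) (auto simp: heights_def one_step_param_def knots_def)
  also have "\<dots> = h * indicator {z. ereal z < knots k (one_step_param k h) 1} y"
    by (subst sum.delta) auto
  finally show ?thesis .
qed

lemma measurable_f_param_one_step [measurable]:
  "f_param k (one_step_param k h) \<in> borel_measurable borel"
  unfolding f_param_one_step[abs_def] by measurable

lemma f_param_one_step_bound: "\<bar>f_param k (one_step_param k h) y\<bar> \<le> \<bar>h\<bar>"
  by (auto simp: f_param_one_step indicator_def)

lemma one_step_param_Theta:
  assumes "\<bar>h\<bar> < R"
  shows "one_step_param k h \<in> Theta k R"
proof -
  have "Linf_norm (f_param k (one_step_param k h)) \<le> ereal \<bar>h\<bar>"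
    unfolding Linf_norm_def by (intro esssup_I) (auto simp: f_param_one_step_bound)
  also have "\<dots> < ereal R"
    using assms by simp
  finally have "f_param k (one_step_param k h) \<in> T_bdd k R"
    using knots_one_step_param_Gamma unfolding T_bdd_def T_def f_param_def by blast
  moreover have "one_step_param k h \<in> {1..2*k+1} \<rightarrow>\<^sub>E UNIV"
    by (simp add: one_step_param_def)
  ultimately show ?thesis
    using knots_one_step_param_Gamma by (simp add: Theta_def)
qed

lemma euclid_dist_one_step_param:
  "euclid_dist (2*k+1) (one_step_param k h) (one_step_param k h') = \<bar>h - h'\<bar>"
proof -
  have "(\<Sum>j\<in>{1..2*k+1}. (one_step_param k h j - one_step_param k h' j)\<^sup>2)
      = (\<Sum>j\<in>{1..2*k+1}. if j = 1 then (h - h')\<^sup>2 else 0)"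
    by (intro sum.cong refl) (auto simp: one_step_param_def)
  also have "\<dots> = (h - h')\<^sup>2"
    by (subst sum.delta) auto
  finally show ?thesis
    by (simp add: euclid_dist_def L2_set_def)
qed

lemma euclid_dist_triangle: "euclid_dist d u w \<le> euclid_dist d v u + euclid_dist d v w"
  using L2_set_triangle_ineq[of "\<lambda>j. u j - v j" "\<lambda>j. v j - w j" "{1..d}"]
  by (simp add: euclid_dist_def L2_set_def power2_commute)

lemma conv_one_step_bound:
  assumes "integrable lborel \<phi>"
  shows "\<bar>conv_op \<phi> (f_param k (one_step_param k h)) x\<bar> \<le> \<bar>h\<bar> * (LBINT y. \<bar>\<phi> y\<bar>)"
proof -
  have [measurable]: "\<phi> \<in> borel_measurable borel"
    using borel_measurable_integrable[OF assms] by simp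
  have int: "integrable lborel (\<lambda>y. \<phi> (x - y))"
    using lborel_integrable_real_affine[OF assms, of "-1" x] by simp
  have bd: "\<bar>\<phi> (x - y) * f_param k (one_step_param k h) y\<bar> \<le> \<bar>h\<bar> * \<bar>\<phi> (x - y)\<bar>" for y
    using mult_right_mono[OF f_param_one_step_bound[of k h y] abs_ge_zero[of "\<phi> (x - y)"]]
    by (simp add: abs_mult mult.commute)
  have "integrable lborel (\<lambda>y. \<phi> (x - y) * f_param k (one_step_param k h) y)"
    by (rule Bochner_Integration.integrable_bound[of _ "\<lambda>y. \<bar>h\<bar> * \<bar>\<phi> (x - y)\<bar>"])
       (use int bd in \<open>auto simp: abs_mult\<close>)
  then have "\<bar>conv_op \<phi> (f_param k (one_step_param k h)) x\<bar> \<le> (LBINT y. \<bar>h\<bar> * \<bar>\<phi> (x - y)\<bar>)"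
    unfolding conv_op_def real_norm_def[symmetric]
    using int bd by (intro Bochner_Integration.integral_norm_bound_integral) auto
  also have "\<dots> = \<bar>h\<bar> * (LBINT y. \<bar>\<phi> y\<bar>)"
    using lborel_integral_real_affine[of "-1" "\<lambda>y. \<bar>\<phi> y\<bar>" x] by simp
  finally show ?thesis .
qed

section \<open>The lower bound\<close>

theorem theorem3p3:
  fixes k :: nat and R \<sigma> :: real and \<phi> :: "real \<Rightarrow> real"
  assumes "R > 0"
    and "assumption_B \<phi>"
    and "\<sigma> > 0"
  shows "\<exists>c\<^sub>0 > (0::real). \<exists>p > (0::ennreal).
    \<forall>n\<ge>1. \<forall>x :: nat \<Rightarrow> real. (\<forall>i\<in>{1..n}. x i \<in> {0..1}) \<longrightarrow>
      (\<forall>(M :: 'a measure) (\<epsilon> :: nat \<Rightarrow> 'a \<Rightarrow> real).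
         prob_space M \<longrightarrow>
         prob_space.indep_vars M (\<lambda>_. borel) \<epsilon> {1..n} \<longrightarrow>
         (\<forall>i\<in>{1..n}. distributed M lborel (\<epsilon> i) (normal_density 0 \<sigma>)) \<longrightarrow>
         p \<le> (INF \<theta>hat \<in> estimators n k. SUP \<theta> \<in> Theta k R.
                emeasure (obs_law M \<epsilon> \<phi> k n x \<theta>)
                  {y \<in> space (obs_law M \<epsilon> \<phi> k n x \<theta>).
                     euclid_dist (2*k+1) (\<theta>hat y) \<theta> \<ge> c\<^sub>0 * real n powr (- 1 / 2)}))"
proof -
  define L where "L = (LBINT y. \<bar>\<phi> y\<bar>)"
  define S where "S = (R / 2 * L)\<^sup>2"
  define p where "p = 1 / (4 * exp (S / (4 * \<sigma>\<^sup>2)))"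
  have \<phi>: "integrable lborel \<phi>"
    using assms(2) by (simp add: assumption_B_def)
  have "L \<ge> 0"
    unfolding L_def by simp
  have "p > 0"
    by (simp add: p_def)
  have main: "ennreal p \<le> (SUP \<theta> \<in> Theta k R.
      emeasure (obs_law M \<epsilon> \<phi> k n x \<theta>)
        {y \<in> space (obs_law M \<epsilon> \<phi> k n x \<theta>).
           euclid_dist (2*k+1) (\<theta>hat y) \<theta> \<ge> R / 4 * real n powr (- 1 / 2)})"
    (is "_ \<le> (SUP \<theta> \<in> _. ?risk \<theta>)")
    if n: "n \<ge> 1" and M: "prob_space M"
      and indep: "prob_space.indep_vars M (\<lambda>_. borel) \<epsilon> {1..n}"
      and normal: "\<forall>i\<in>{1..n}. distributed M lborel (\<epsilon> i) (normal_density 0 \<sigma>)"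
      and est: "\<theta>hat \<in> estimators n k"
    for n and x :: "nat \<Rightarrow> real" and M :: "'a measure" and \<epsilon> \<theta>hat
  proof -
    interpret prob_space M by fact
    define h where "h = R / 2 * real n powr (- 1 / 2)"
    define r where "r = R / 4 * real n powr (- 1 / 2)"
    have h: "h = 2 * r" "h > 0"
      using n \<open>R > 0\<close> by (auto simp: h_def r_def)
    have "real n powr (- 1 / 2) \<le> 1"
      using powr_mono[of "- 1 / 2" 0 "real n"] n by simp
    then have "h \<le> R / 2"
      using \<open>R > 0\<close> mult_left_mono[of "real n powr (- 1 / 2)" 1 "R / 2"] by (simp add: h_def)
    then have \<Theta>: "one_step_param k 0 \<in> Theta k R" "one_step_param k h \<in> Theta k R"
      using h \<open>R > 0\<close> by (auto intro!: one_step_param_Theta)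
    define \<mu> where "\<mu> = (\<lambda>t i. conv_op \<phi> (f_param k (one_step_param k t)) (x i))"
    define P where "P = (\<lambda>t. gaussian_law {1..n} (\<mu> t) \<sigma>)"
    have law: "obs_law M \<epsilon> \<phi> k n x (one_step_param k t) = P t" for t
      unfolding obs_law_def P_def \<mu>_def
      using n indep normal assms(3) by (intro distr_shifted_normal) auto
    define \<Omega> where "\<Omega> = space (Pi\<^sub>M {1..n} (\<lambda>_. borel :: real measure))"
    have space_P: "space (P t) = \<Omega>" for t
      unfolding P_def \<Omega>_def by (rule sets_eq_imp_space_eq[OF sets_gaussian_law])
    have [measurable]: "\<theta>hat \<in> measurable (Pi\<^sub>M {1..n} (\<lambda>_. borel)) (Pi\<^sub>M {1..2*k+1} (\<lambda>_. borel))"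
      using est by (simp add: estimators_def)
    define A where "A = (\<lambda>t. {y \<in> \<Omega>. euclid_dist (2*k+1) (\<theta>hat y) (one_step_param k t) \<ge> r})"
    have A: "A t \<in> sets (Pi\<^sub>M {1..n} (\<lambda>_. borel))" for t
      unfolding A_def \<Omega>_def euclid_dist_def L2_set_def by measurable
    have risk: "?risk (one_step_param k t) = ennreal (measure (P t) (A t))" for t
    proof -
      interpret P: prob_space "P t"
        unfolding P_def using assms(3) by (intro prob_space_gaussian_law) auto
      show ?thesis
        unfolding law space_P A_def r_def by (rule P.emeasure_eq_measure)
    qed
    \<comment> \<open>The bound is the same at every design point, so the \<open>n\<close> coordinates add up to at most
      \<open>S\<close> whatever the design.\<close>
    have "(\<mu> 0 i - \<mu> h i)\<^sup>2 \<le> S / real n" for i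
    proof -
      have "\<mu> 0 i = 0"
        using conv_one_step_bound[OF \<phi>, of k 0 "x i"] by (simp add: \<mu>_def)
      then have "(\<mu> 0 i - \<mu> h i)\<^sup>2 \<le> (h * L)\<^sup>2"
        using conv_one_step_bound[OF \<phi>, of k h "x i"] h \<open>L \<ge> 0\<close>
        by (simp add: \<mu>_def L_def abs_le_square_iff[symmetric] abs_mult)
      also have "\<dots> = S * (real n powr (- 1 / 2))\<^sup>2"
        by (simp add: h_def S_def power2_eq_square)
      also have "(real n powr (- 1 / 2))\<^sup>2 = 1 / real n"
        using n by (simp add: powr_power powr_minus field_simps)
      finally show ?thesis by simp
    qed
    then have "(\<Sum>i\<in>{1..n}. (\<mu> 0 i - \<mu> h i)\<^sup>2) \<le> (\<Sum>i\<in>{1..n}. S / real n)"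
      by (rule sum_mono)
    also have "\<dots> = S"
      using n by simp
    finally have "1 / (2 * exp (S / (4 * \<sigma>\<^sup>2))) \<le> measure (P 0) (A 0) + measure (P h) (\<Omega> - A 0)"
      unfolding P_def \<Omega>_def using A assms(3) by (intro gaussian_testing_bound) auto
    also have "measure (P h) (\<Omega> - A 0) \<le> measure (P h) (A h)"
    proof -
      interpret P: prob_space "P h"
        unfolding P_def using assms(3) by (intro prob_space_gaussian_law) auto
      have "\<Omega> - A 0 \<subseteq> A h"
      proof
        fix y assume y: "y \<in> \<Omega> - A 0"
        have "h \<le> euclid_dist (2*k+1) (\<theta>hat y) (one_step_param k 0)
            + euclid_dist (2*k+1) (\<theta>hat y) (one_step_param k h)"
          using euclid_dist_triangle[of "2*k+1" "one_step_param k 0" "one_step_param k h" "\<theta>hat y"] h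
          unfolding euclid_dist_one_step_param by simp
        then show "y \<in> A h"
          using y h by (auto simp: A_def)
      qed
      then show ?thesis
        using A by (intro P.finite_measure_mono) (auto simp: P_def sets_gaussian_law)
    qed
    finally have "2 * p \<le> measure (P 0) (A 0) + measure (P h) (A h)"
      by (simp add: p_def)
    then have "p \<le> measure (P 0) (A 0) \<or> p \<le> measure (P h) (A h)"
      by linarith
    then have "ennreal p \<le> ?risk (one_step_param k 0) \<or> ennreal p \<le> ?risk (one_step_param k h)"
      unfolding risk by (auto intro: ennreal_leI)
    then show ?thesis
      using \<Theta> by (auto intro: SUP_upper2)
  qed
  show ?thesis
    by (intro exI[of _ "R / 4"] exI[of _ "ennreal p"] conjI allI impI INF_greatest main)
       (use \<open>R > 0\<close> \<open>p > 0\<close> in auto)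
qed

end
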